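(* Let $s\in(1,\infty)$ and let $r\in(0,1)$ be fixed. Define, for $p\in(0,1)$, $$f_{p|r,s}(p)=\frac{1}{\zeta(s)\,\Gamma(s)\,(1-p)^r}\left[(s-1)\int_p^1\frac{(\omega-p)^{r-1}(-\ln\omega)^{s-2}}{\omega^{r}}\,d\omega+(r-1)\int_p^1\frac{(\omega-p)^{r-1}(-\ln\omega)^{s-1}}{\omega^{r}}\,d\omega\right].$$ Then $f_{p|r,s}$ is a quasi-probability density function on $(0,1)$ (in particular, it assumes negative values for some $p\in(0,1)$), and the $\mathrm{Zeta}(s)$ distribution is the mixture over $p$ of the $\mathrm{Negative\ Binomial}(r,p)$ distributions with mixing quasi-density $f_{p|r,s}$; that is, for every $x\in\{0,1,2,\ldots\}$, $$\int_0^1 \frac{\Gamma(r+x)}{\Gamma(r)\Gamma(x+1)}\,p^x(1-p)^r\, f_{p|r,s}(p)\,dp=\frac{(x+1)^{-s}}{\zeta(s)}.$$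
   Context: $\zeta(s)=\sum_{x=0}^{\infty}(x+1)^{-s}$ is the Riemann zeta function (for $s>1$) and $\Gamma$ is the Gamma function. The $\mathrm{Zeta}(s)$ distribution, $s\in(1,\infty)$, is the distribution on $\{0,1,2,\ldots\}$ with probability mass function $\frac{(x+1)^{-s}}{\zeta(s)}$. The $\mathrm{Negative\ Binomial}(r,p)$ distribution, $r\in(0,\infty)$, $p\in(0,1)$, is the distribution on $\{0,1,2,\ldots\}$ with probability mass function $\frac{\Gamma(r+x)}{\Gamma(r)\Gamma(x+1)}p^x(1-p)^r$. A quasi-probability density function on $(0,1)$ is a real-valued integrable function on $(0,1)$ with total integral $1$ that assumes some negative values. *)

theory Defs
  imports "HOL-Analysis.Analysis"
begin

definition real_zeta :: "real \<Rightarrow> real" where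
  "real_zeta s = (\<Sum>x. real (x + 1) powr (- s))"

definition zeta_mass :: "real \<Rightarrow> nat \<Rightarrow> real" where
  "zeta_mass s x = real (x + 1) powr (- s) / real_zeta s"

text \<open>The parameter \<open>r\<close> is an arbitrary positive real, and \<open>p\<close> (not \<open>1 - p\<close>) is
  raised to the power \<open>x\<close>.\<close>

definition neg_binomial_mass :: "real \<Rightarrow> real \<Rightarrow> nat \<Rightarrow> real" where
  "neg_binomial_mass r p x =
     Gamma (r + real x) / (Gamma r * Gamma (real x + 1)) * p ^ x * (1 - p) powr r"

text \<open>Only the values on the open unit interval matter in the next two definitions.\<close>

definition quasi_density_01 :: "(real \<Rightarrow> real) \<Rightarrow> bool" where
  "quasi_density_01 f \<longleftrightarrow>
     set_integrable lborel {0<..<1} f \<and>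
     (LBINT p:{0<..<1}. f p) = 1 \<and>
     (\<exists>p\<in>{0<..<1}. f p < 0)"

definition is_mixture_01 :: "(nat \<Rightarrow> real) \<Rightarrow> (real \<Rightarrow> nat \<Rightarrow> real) \<Rightarrow> (real \<Rightarrow> real) \<Rightarrow> bool" where
  "is_mixture_01 m k f \<longleftrightarrow>
     (\<forall>x. set_integrable lborel {0<..<1} (\<lambda>p. k p x * f p) \<and>
          (LBINT p:{0<..<1}. k p x * f p) = m x)"

definition mixing_quasi_density :: "real \<Rightarrow> real \<Rightarrow> real \<Rightarrow> real" where
  "mixing_quasi_density r s p =
     1 / (real_zeta s * Gamma s * (1 - p) powr r) *
     ((s - 1) * (LBINT w:{p<..<1}. (w - p) powr (r - 1) * (- ln w) powr (s - 2) / w powr r) +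
      (r - 1) * (LBINT w:{p<..<1}. (w - p) powr (r - 1) * (- ln w) powr (s - 1) / w powr r))"

end

theory Submission imports Defs begin

text \<open>
  Up to normalisation the quasi-density is \<open>(1 - p) powr (- r)\<close> times a linear combination,
  with coefficients of opposite signs, of the two nonnegative functions \<open>K (s - 1)\<close> and \<open>K s\<close>,
  where \<open>K a p\<close> is the fractional integral of order \<open>r\<close> of a power of the logarithm
  (\<open>log_kernel_integral\<close>). Everything follows from the Mellin transform of these functions:
  by Tonelli, \<open>\<integral> p powr x * K a p\<close> splits into a Beta integral in \<open>p\<close> and a Gamma
  integral in \<open>w\<close>, with value \<open>Beta (x + 1) r * Gamma a * (x + 1) powr (- a)\<close> for every real
  \<open>x > -1\<close>. Since \<open>Gamma s = (s - 1) * Gamma (s - 1)\<close>, the two contributions combine with the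
  factor \<open>(x + 1) - (1 - r) = x + r\<close>
  (\<open>weighted_moment_mixing_quasi_density\<close>), and all three claims are read off from that:

  \<^item> For \<open>x = n\<close> a natural number, the negative binomial coefficient times the Beta value is
    \<open>1 / (r + n)\<close>, which cancels the factor \<open>n + r\<close> and leaves the zeta mass.

  \<^item> For the total integral, \<open>(1 - p) powr (- r)\<close> is expanded by the negative binomial series.
    Its terms and \<open>K a\<close> are nonnegative, so integration is termwise and gives
    \<open>Gamma a * (\<Sum>n. (n + 1) powr (- a) / (r + n))\<close>, a convergent series already for
    \<open>a > 0\<close>. This yields absolute integrability, and the same cancellation reduces the combined
    series to the zeta series.

  \<^item> For negativity, the moment is evaluated at an exponent \<open>x\<close> strictly between \<open>-1\<close> and
    \<open>- r\<close>. There \<open>x + r < 0\<close> while all other factors are positive, so a nonnegative weight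
    has a negative integral against the quasi-density. Such an exponent exists because
    \<open>r < 1\<close>.
\<close>

section \<open>Gamma and Beta integrals\<close>

text \<open>Euler's integral for Gamma, transported to the unit interval by
  \<open>w = exp (- t / (x + 1))\<close>. Scaling \<open>t\<close> already inside the exponential makes
  \<open>w powr x\<close> and the Jacobian multiply to \<open>exp (- t)\<close> exactly.\<close>

lemma nn_integral_powr_times_log_powr:
  fixes a x :: real
  assumes "0 < a" "-1 < x"
  shows "(\<integral>\<^sup>+w. ennreal (indicator {0<..<1} w * (w powr x * (- ln w) powr (a - 1))) \<partial>lborel)
           = ennreal (Gamma a * (x + 1) powr (- a))"
proof -
  define c where "c = x + 1"
  have c: "0 < c" using assms by (simp add: c_def)
  let ?f = "\<lambda>w. w powr x * (- ln w) powr (a - 1) :: real"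
  let ?g = "\<lambda>t. exp (- t / c)" and ?g' = "\<lambda>t. - exp (- t / c) / c"
  let ?h = "\<lambda>t. c powr (- a) * (t powr (a - 1) / exp t)"
  have G: "((\<lambda>t. t powr (a - 1) / exp t) has_integral Gamma a) {0<..}"
    using Gamma_integral_real[OF assms(1)]
    by (subst (asm) has_integral_spike_set_eq[where T = "{0<..}"])
      (auto intro!: negligible_subset[OF negligible_sing[of 0]])
  have h: "(?h has_integral c powr (- a) * Gamma a) {0<..}"
    by (intro has_integral_mult_right G)
  have eq: "\<bar>?g' t\<bar> * ?f (?g t) = ?h t" if "t \<in> {0<..}" for t
  proof -
    have exp_part: "exp (- t / c) powr x * exp (- t / c) = exp (- t)"
    proof -
      have "x * (- t / c) + - t / c = - t"
        using c by (simp add: c_def divide_simps) (simp add: algebra_simps)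
      then show ?thesis by (simp add: powr_def mult_exp_exp)
    qed
    have powr_part: "(t / c) powr (a - 1) / c = c powr (- a) * t powr (a - 1)"
      using c that by (simp add: powr_divide powr_diff powr_minus field_simps)
    have split: "\<bar>?g' t\<bar> * ?f (?g t)
        = (exp (- t / c) powr x * exp (- t / c)) * ((t / c) powr (a - 1) / c)"
      using c by simp
    show ?thesis
      unfolding split exp_part powr_part by (simp add: exp_minus divide_inverse mult_ac)
  qed
  have img: "?g ` {0<..} = {0<..<1}"
  proof (intro equalityI subsetI)
    fix w :: real assume w: "w \<in> {0<..<1}"
    then have "w = ?g (- c * ln w)" "- c * ln w \<in> {0<..}"
      using c by (auto simp: mult_less_0_iff)
    then show "w \<in> ?g ` {0<..}" by blast
  qed (use c in \<open>auto simp: divide_less_0_iff\<close>)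
  have h_abs: "?h absolutely_integrable_on {0<..}"
    using h by (intro nonnegative_absolutely_integrable_1) (auto simp: has_integral_integrable)
  have "(\<lambda>t. \<bar>?g' t\<bar> * ?f (?g t)) absolutely_integrable_on {0<..} \<and>
        integral {0<..} (\<lambda>t. \<bar>?g' t\<bar> * ?f (?g t)) = c powr (- a) * Gamma a"
  proof
    show "(\<lambda>t. \<bar>?g' t\<bar> * ?f (?g t)) absolutely_integrable_on {0<..}"
      using h_abs eq set_integrable_cong[OF refl refl, of "{0<..}" "\<lambda>t. \<bar>?g' t\<bar> * ?f (?g t)" ?h lebesgue]
      by blast
    have "((\<lambda>t. \<bar>?g' t\<bar> * ?f (?g t)) has_integral c powr (- a) * Gamma a) {0<..}"
      using h eq by (subst has_integral_cong[where g = ?h]) auto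
    then show "integral {0<..} (\<lambda>t. \<bar>?g' t\<bar> * ?f (?g t)) = c powr (- a) * Gamma a"
      by (rule integral_unique)
  qed
  then have "?f absolutely_integrable_on ?g ` {0<..} \<and> integral (?g ` {0<..}) ?f = c powr (- a) * Gamma a"
    using c
    by (subst (asm) has_absolute_integral_change_of_variables_1')
      (auto intro!: derivative_eq_intros simp: inj_on_def field_simps)
  then have "(?f has_integral c powr (- a) * Gamma a) {0<..<1}"
    unfolding img by (auto simp: has_integral_iff set_lebesgue_integral_eq_integral)
  from nn_integral_has_integral_lebesgue[OF _ this]
  show ?thesis by (simp add: c_def mult.commute)
qed

text \<open>The Beta integral under the dilation \<open>p = w * t\<close>.\<close>

lemma nn_integral_Beta_scaled:
  fixes x r w :: real
  assumes "-1 < x" "0 < r" "0 < w"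
  shows "(\<integral>\<^sup>+p. ennreal (indicator {0<..<w} p * (p powr x * (w - p) powr (r - 1))) \<partial>lborel)
           = ennreal (w powr (x + r) * Beta (x + 1) r)"
proof -
  have "((\<lambda>t. t powr x * (1 - t) powr (r - 1)) has_integral Beta (x + 1) r) {0<..<1}"
    using has_integral_Beta_real[of "x + 1" r] assms by (simp add: has_integral_Icc_iff_Ioo)
  then have B: "(\<integral>\<^sup>+t. ennreal (indicator {0<..<1} t * (t powr x * (1 - t) powr (r - 1))) \<partial>lborel)
      = ennreal (Beta (x + 1) r)"
    by (intro nn_integral_has_integral_lebesgue) auto
  have eq: "indicator {0<..<w} (0 + w * t) * ((0 + w * t) powr x * (w - (0 + w * t)) powr (r - 1))
      = w powr (x + r - 1) * (indicator {0<..<1} t * (t powr x * (1 - t) powr (r - 1)))" for t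
  proof (cases "t \<in> {0<..<1}")
    case True
    have "w - w * t = w * (1 - t)" by (simp add: algebra_simps)
    then have "(w - w * t) powr (r - 1) = w powr (r - 1) * (1 - t) powr (r - 1)"
      using True assms by (simp add: powr_mult)
    moreover have "w powr (x + r - 1) = w powr x * w powr (r - 1)"
      by (simp add: powr_add[symmetric] algebra_simps)
    ultimately show ?thesis using True assms
      by (simp add: powr_mult)
  next
    case False
    then have "w * t \<notin> {0<..<w}" using assms by (auto simp: zero_less_mult_iff)
    with False show ?thesis by simp
  qed
  have "(\<integral>\<^sup>+p. ennreal (indicator {0<..<w} p * (p powr x * (w - p) powr (r - 1))) \<partial>lborel)
      = ennreal \<bar>w\<bar> * (\<integral>\<^sup>+t. ennreal (w powr (x + r - 1) *
          (indicator {0<..<1} t * (t powr x * (1 - t) powr (r - 1)))) \<partial>lborel)"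
    using assms by (subst nn_integral_real_affine[where c = w and t = 0]) (auto simp only: eq, measurable)
  also have "\<dots> = ennreal w * (ennreal (w powr (x + r - 1)) * ennreal (Beta (x + 1) r))"
    using assms by (simp add: ennreal_mult'[OF powr_ge_zero] nn_integral_cmult B)
  also have "\<dots> = ennreal (w powr (x + r) * Beta (x + 1) r)"
    using assms by (simp add: ennreal_mult'[symmetric] powr_diff)
  finally show ?thesis .
qed

section \<open>The fractional integral of a power of the logarithm\<close>

text \<open>Up to the factor \<open>Gamma r\<close>, this is the right-sided (Weyl) fractional integral of order
  \<open>r\<close> of \<open>\<lambda>w. (- ln w) powr (a - 1) / w powr r\<close>. The exponent is shifted by one so that
  \<open>a\<close> is the argument of the Gamma factor in its moments. At points \<open>p\<close> where the integrand
  is not integrable the value is \<open>0\<close>.\<close>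

definition log_kernel_integral :: "real \<Rightarrow> real \<Rightarrow> real \<Rightarrow> real" where
  "log_kernel_integral r a p =
     (LBINT w:{p<..<1}. (w - p) powr (r - 1) * (- ln w) powr (a - 1) / w powr r)"

lemma log_kernel_integral_nonneg: "0 \<le> log_kernel_integral r a p"
  unfolding log_kernel_integral_def set_lebesgue_integral_def
  by (intro integral_nonneg_AE) auto

lemma borel_measurable_log_kernel_integral [measurable]:
  "log_kernel_integral r a \<in> borel_measurable borel"
proof -
  have "(\<lambda>p. \<integral>w. (if p < w \<and> w < 1 then (w - p) powr (r - 1) * (- ln w) powr (a - 1) / w powr r
          else 0) \<partial>lborel) \<in> borel_measurable borel"
    by measurable
  also have "(\<lambda>p. \<integral>w. (if p < w \<and> w < 1 then (w - p) powr (r - 1) * (- ln w) powr (a - 1) / w powr r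
          else 0) \<partial>lborel) = log_kernel_integral r a"
    unfolding log_kernel_integral_def set_lebesgue_integral_def
    by (intro ext Bochner_Integration.integral_cong) auto
  finally show ?thesis .
qed

text \<open>The Mellin transform. For fixed \<open>w\<close> the inner integral over \<open>p\<close> is a Beta integral
  whose power \<open>w powr (x + r)\<close> absorbs the denominator \<open>w powr r\<close>; what remains is a Gamma
  integral in \<open>w\<close>. The integrals are taken in the extended nonnegative reals so that the order of
  integration may be exchanged without knowing integrability in advance; the finiteness of the result
  then shows that the default value \<open>0\<close> is taken at most on a null set.\<close>

lemma nn_integral_powr_log_kernel:
  fixes x r a :: real
  assumes x: "-1 < x" and r: "0 < r" and a: "0 < a"
  shows "(\<integral>\<^sup>+p. ennreal (indicator {0<..<1} p * (p powr x * log_kernel_integral r a p)) \<partial>lborel)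
           = ennreal (Beta (x + 1) r * (Gamma a * (x + 1) powr (- a)))"
proof -
  define k where "k p w = (if p < w \<and> w < 1
      then (w - p) powr (r - 1) * (- ln w) powr (a - 1) / w powr r else 0)" for p w :: real
  define N where "N p = (\<integral>\<^sup>+w. ennreal (k p w) \<partial>lborel)" for p
  have [measurable]: "(\<lambda>(p, w). k p w) \<in> borel_measurable (borel \<Otimes>\<^sub>M borel)"
    unfolding k_def by measurable
  have k0: "0 \<le> k p w" for p w by (auto simp: k_def)
  have Beta: "0 \<le> Beta (x + 1) r"
    using x r by (simp add: Beta_def)
  have K: "log_kernel_integral r a p = enn2real (N p)" for p
  proof -
    have "log_kernel_integral r a p = (\<integral>w. k p w \<partial>lborel)"
      unfolding log_kernel_integral_def set_lebesgue_integral_def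
      by (intro Bochner_Integration.integral_cong) (auto simp: k_def)
    also have "\<dots> = enn2real (N p)"
      unfolding N_def by (intro integral_eq_nn_integral) (auto simp: k0)
    finally show ?thesis .
  qed
  let ?u = "\<lambda>p::real. indicator {0<..<1} p * p powr x"
  have "(\<integral>\<^sup>+p. ennreal (?u p) * N p \<partial>lborel)
      = (\<integral>\<^sup>+p. (\<integral>\<^sup>+w. ennreal (?u p * k p w) \<partial>lborel) \<partial>lborel)"
    unfolding N_def by (simp add: nn_integral_cmult[symmetric] ennreal_mult' k0)
  also have "\<dots> = (\<integral>\<^sup>+w. (\<integral>\<^sup>+p. ennreal (?u p * k p w) \<partial>lborel) \<partial>lborel)"
    by (rule lborel_pair.Fubini'[symmetric]) measurable
  also have "\<dots> = (\<integral>\<^sup>+w. ennreal (Beta (x + 1) r *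
      (indicator {0<..<1} w * (w powr x * (- ln w) powr (a - 1)))) \<partial>lborel)"
  proof (intro nn_integral_cong)
    fix w :: real
    show "(\<integral>\<^sup>+p. ennreal (?u p * k p w) \<partial>lborel)
      = ennreal (Beta (x + 1) r * (indicator {0<..<1} w * (w powr x * (- ln w) powr (a - 1))))"
    proof (cases "w \<in> {0<..<1}")
      case True
      have "(\<integral>\<^sup>+p. ennreal (?u p * k p w) \<partial>lborel)
          = (\<integral>\<^sup>+p. ennreal ((- ln w) powr (a - 1) / w powr r) *
               ennreal (indicator {0<..<w} p * (p powr x * (w - p) powr (r - 1))) \<partial>lborel)"
        using True
        by (intro nn_integral_cong)
          (auto simp: k_def ennreal_mult'[symmetric] mult_ac split: split_indicator)
      also have "\<dots> = ennreal ((- ln w) powr (a - 1) / w powr r) *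
          ennreal (w powr (x + r) * Beta (x + 1) r)"
        using True x r by (simp add: nn_integral_cmult nn_integral_Beta_scaled)
      also have "\<dots> = ennreal (Beta (x + 1) r * (w powr x * (- ln w) powr (a - 1)))"
        using True by (simp add: ennreal_mult'[symmetric] powr_add field_simps)
      finally show ?thesis using True by simp
    next
      case False
      then have zero: "?u p * k p w = 0" for p
        by (auto simp: k_def split: split_indicator)
      show ?thesis unfolding zero using False by simp
    qed
  qed
  also have "\<dots> = ennreal (Beta (x + 1) r * (Gamma a * (x + 1) powr (- a)))"
    using Beta a x
    by (simp add: ennreal_mult'[OF Beta] nn_integral_cmult nn_integral_powr_times_log_powr)
  finally have J: "(\<integral>\<^sup>+p. ennreal (?u p) * N p \<partial>lborel)
      = ennreal (Beta (x + 1) r * (Gamma a * (x + 1) powr (- a)))" .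
  have [measurable]: "N \<in> borel_measurable borel"
    unfolding N_def by measurable
  \<comment> \<open>Where \<open>N p\<close> is infinite, \<open>enn2real (N p)\<close> is \<open>0\<close>, so the two integrands agree only
      almost everywhere.\<close>
  have "AE p in lborel. ennreal (?u p) * N p \<noteq> \<infinity>"
    by (rule nn_integral_PInf_AE) (auto simp: J)
  then have "AE p in lborel. ennreal (indicator {0<..<1} p * (p powr x * log_kernel_integral r a p))
      = ennreal (?u p) * N p"
  proof (rule eventually_mono)
    fix p :: real assume fin: "ennreal (?u p) * N p \<noteq> \<infinity>"
    show "ennreal (indicator {0<..<1} p * (p powr x * log_kernel_integral r a p))
      = ennreal (?u p) * N p"
    proof (cases "p \<in> {0<..<1}")
      case True
      then have "N p < top"
        using fin by (auto simp: ennreal_mult_eq_top_iff top.not_eq_extremum)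
      then show ?thesis using True
        by (simp add: K ennreal_mult')
    qed simp
  qed
  then have "(\<integral>\<^sup>+p. ennreal (indicator {0<..<1} p * (p powr x * log_kernel_integral r a p)) \<partial>lborel)
      = (\<integral>\<^sup>+p. ennreal (?u p) * N p \<partial>lborel)"
    by (rule nn_integral_cong_AE)
  with J show ?thesis by simp
qed

lemma has_bochner_integral_powr_log_kernel:
  fixes x r a :: real
  assumes "-1 < x" and "0 < r" and "0 < a"
  shows "has_bochner_integral lborel
           (\<lambda>p. indicator {0<..<1} p * (p powr x * log_kernel_integral r a p))
           (Beta (x + 1) r * (Gamma a * (x + 1) powr (- a)))"
  by (rule has_bochner_integral_nn_integral)
    (use assms nn_integral_powr_log_kernel[OF assms] in
      \<open>auto simp: log_kernel_integral_nonneg Beta_def\<close>)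

section \<open>The negative binomial series\<close>

text \<open>This is the binomial series with exponent \<open>- r\<close> at \<open>- p\<close>; the signs cancel and the rising
  factorials of \<open>r\<close> are quotients of Gamma values.\<close>

lemma negative_binomial_series:
  fixes r p :: real
  assumes "0 < r" "\<bar>p\<bar> < 1"
  shows "(\<lambda>n. Gamma (r + real n) / (Gamma r * Gamma (real n + 1)) * p ^ n) sums (1 - p) powr (- r)"
proof -
  have "((- r) gchoose n) * (- p) ^ n = Gamma (r + real n) / (Gamma r * Gamma (real n + 1)) * p ^ n"
    for n
  proof -
    have "((- r) gchoose n) * (- p) ^ n = ((- 1) * (- p)) ^ n * (pochhammer r n / fact n)"
      unfolding gbinomial_pochhammer power_mult_distrib by simp
    also have "\<dots> = Gamma (r + real n) / (Gamma r * Gamma (real n + 1)) * p ^ n"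
      using assms by (simp add: pochhammer_Gamma nonpos_Ints_def Gamma_fact add.commute[of _ 1])
    finally show ?thesis .
  qed
  with gen_binomial_real[of "- p" "- r"] assms show ?thesis by simp
qed

lemma negative_binomial_coeff_times_Beta:
  fixes r :: real
  assumes "0 < r"
  shows "Gamma (r + real n) / (Gamma r * Gamma (real n + 1)) * Beta (real n + 1) r = 1 / (r + real n)"
proof -
  have "Gamma (real n + 1 + r) = (r + real n) * Gamma (r + real n)"
    using Gamma_plus1[of "r + real n"] assms by (auto simp: add_ac nonpos_Ints_def)
  moreover have "Gamma y \<noteq> 0" if "0 < y" for y :: real
    using Gamma_real_pos[OF that] by simp
  then have "Gamma r \<noteq> 0" "Gamma (real n + 1) \<noteq> 0" "Gamma (r + real n) \<noteq> 0"
    using assms by auto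
  ultimately show ?thesis
    using assms by (simp add: Beta_def del: Gamma_eq_zero_iff)
qed

text \<open>Comparison with the series of \<open>(n + 1) powr (- a - 1)\<close>, using that \<open>n + 1\<close> is at most
  \<open>max 1 (1 / r)\<close> times \<open>r + n\<close>.\<close>

lemma summable_powr_over_shift:
  fixes r a :: real
  assumes "0 < r" "0 < a"
  shows "summable (\<lambda>n. (real n + 1) powr (- a) / (r + real n))"
proof (rule summable_comparison_test)
  have "summable (\<lambda>n. real (Suc n) powr (- a - 1))"
    using assms by (subst summable_Suc_iff) (simp add: summable_real_powr_iff)
  then show "summable (\<lambda>n. max 1 (1 / r) * (real n + 1) powr (- a - 1))"
    by (intro summable_mult) (simp add: add.commute)
  show "\<exists>N. \<forall>n\<ge>N. norm ((real n + 1) powr (- a) / (r + real n))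
      \<le> max 1 (1 / r) * (real n + 1) powr (- a - 1)"
  proof (intro exI[of _ 0] allI impI)
    fix n :: nat
    have "real n + 1 \<le> max 1 (1 / r) * (r + real n)"
    proof -
      have "1 \<le> max 1 (1 / r) * r"
        using mult_right_mono[of "1 / r" "max 1 (1 / r)" r] assms by simp
      moreover have "1 * real n \<le> max 1 (1 / r) * real n"
        by (intro mult_right_mono) auto
      ultimately show ?thesis by (simp add: distrib_left)
    qed
    then have "1 / (r + real n) \<le> max 1 (1 / r) / (real n + 1)"
      using assms by (simp add: divide_simps mult.commute del: max_less_iff_conj)
    then have "(real n + 1) powr (- a) * (1 / (r + real n))
        \<le> (real n + 1) powr (- a) * (max 1 (1 / r) / (real n + 1))"
      by (intro mult_left_mono) auto
    then show "norm ((real n + 1) powr (- a) / (r + real n))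
        \<le> max 1 (1 / r) * (real n + 1) powr (- a - 1)"
      using assms by (simp add: powr_diff mult_ac)
  qed
qed

text \<open>The weight \<open>(1 - p) powr (- r)\<close> is unbounded at \<open>1\<close>, but it is a power series in
  \<open>p\<close> with nonnegative coefficients, so its integral against the kernel is the sum of the moments
  with natural exponents.\<close>

lemma has_bochner_integral_log_kernel_over_powr:
  fixes r a :: real
  assumes r: "0 < r" and a: "0 < a"
  shows "has_bochner_integral lborel
           (\<lambda>p. indicator {0<..<1} p * ((1 - p) powr (- r) * log_kernel_integral r a p))
           (Gamma a * (\<Sum>n. (real n + 1) powr (- a) / (r + real n)))"
proof (rule has_bochner_integral_nn_integral)
  let ?K = "log_kernel_integral r a"
  let ?c = "\<lambda>n. Gamma (r + real n) / (Gamma r * Gamma (real n + 1))"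
  have c: "0 \<le> ?c n" for n
    using r by (intro divide_nonneg_pos mult_pos_pos less_imp_le[OF Gamma_real_pos] Gamma_real_pos) auto
  note K = log_kernel_integral_nonneg[of r a]
  have "(\<integral>\<^sup>+p. ennreal (indicator {0<..<1} p * ((1 - p) powr (- r) * ?K p)) \<partial>lborel)
      = (\<integral>\<^sup>+p. (\<Sum>n. ennreal (?c n) * ennreal (indicator {0<..<1} p * (p powr real n * ?K p))) \<partial>lborel)"
  proof (intro nn_integral_cong)
    fix p :: real
    show "ennreal (indicator {0<..<1} p * ((1 - p) powr (- r) * ?K p))
      = (\<Sum>n. ennreal (?c n) * ennreal (indicator {0<..<1} p * (p powr real n * ?K p)))"
    proof (cases "p \<in> {0<..<1}")
      case True
      have "(\<lambda>n. ?c n * p ^ n * ?K p) sums ((1 - p) powr (- r) * ?K p)"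
        using True r by (intro sums_mult2 negative_binomial_series) auto
      then have "(\<Sum>n. ennreal (?c n * p ^ n * ?K p)) = ennreal ((1 - p) powr (- r) * ?K p)"
        using True
        by (intro suminf_ennreal_eq mult_nonneg_nonneg c K) auto
      then show ?thesis
        using True c K by (simp add: ennreal_mult'[symmetric] powr_realpow mult.assoc)
    qed simp
  qed
  also have "\<dots> = (\<Sum>n. ennreal (?c n) *
      (\<integral>\<^sup>+p. ennreal (indicator {0<..<1} p * (p powr real n * ?K p)) \<partial>lborel))"
    by (subst nn_integral_suminf) (auto simp: nn_integral_cmult)
  also have "\<dots> = (\<Sum>n. ennreal (Gamma a * ((real n + 1) powr (- a) / (r + real n))))"
  proof (intro suminf_cong)
    fix n
    have "ennreal (?c n) * (\<integral>\<^sup>+p. ennreal (indicator {0<..<1} p * (p powr real n * ?K p)) \<partial>lborel)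
       = ennreal (?c n * Beta (real n + 1) r * (Gamma a * (real n + 1) powr (- a)))"
      using r a c by (simp add: nn_integral_powr_log_kernel ennreal_mult'[symmetric] mult.assoc)
    then show "ennreal (?c n) *
        (\<integral>\<^sup>+p. ennreal (indicator {0<..<1} p * (p powr real n * ?K p)) \<partial>lborel)
       = ennreal (Gamma a * ((real n + 1) powr (- a) / (r + real n)))"
      unfolding negative_binomial_coeff_times_Beta[OF r] by (simp add: mult_ac)
  qed
  also have "\<dots> = ennreal (Gamma a * (\<Sum>n. (real n + 1) powr (- a) / (r + real n)))"
    using r a
    by (intro suminf_ennreal_eq sums_mult summable_sums summable_powr_over_shift) auto
  finally show "(\<integral>\<^sup>+p. ennreal (indicator {0<..<1} p * ((1 - p) powr (- r) * ?K p)) \<partial>lborel)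
      = ennreal (Gamma a * (\<Sum>n. (real n + 1) powr (- a) / (r + real n)))" .
  show "0 \<le> Gamma a * (\<Sum>n. (real n + 1) powr (- a) / (r + real n))"
    using r a by (intro mult_nonneg_nonneg suminf_nonneg summable_powr_over_shift) auto
qed (auto simp: log_kernel_integral_nonneg)

section \<open>Moments, total integral and sign of the quasi-density\<close>

lemma mixing_quasi_density_eq:
  assumes "p < 1"
  shows "mixing_quasi_density r s p = (1 - p) powr (- r) *
    ((s - 1) * log_kernel_integral r (s - 1) p - (1 - r) * log_kernel_integral r s p) /
    (real_zeta s * Gamma s)"
  using assms unfolding mixing_quasi_density_def log_kernel_integral_def
  by (simp add: powr_minus field_simps diff_diff_eq)

text \<open>The weight \<open>(1 - p) powr r\<close> cancels the singular factor of the quasi-density. Allowing real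
  exponents \<open>x > -1\<close> serves two purposes: natural exponents give the mixture identity, while the
  sign change of the factor \<open>x + r\<close> detects negative values.\<close>

lemma weighted_moment_mixing_quasi_density:
  fixes r s x :: real
  assumes s: "1 < s" and r: "0 < r" and x: "-1 < x"
  shows "has_bochner_integral lborel
     (\<lambda>p. indicator {0<..<1} p * (p powr x * (1 - p) powr r * mixing_quasi_density r s p))
     (Beta (x + 1) r * (x + r) * (x + 1) powr (- s) / real_zeta s)"
proof -
  let ?K = "\<lambda>a p. indicator {0<..<1} p * (p powr x * log_kernel_integral r a p)"
  have G: "Gamma s = (s - 1) * Gamma (s - 1)"
    using Gamma_plus1[of "s - 1"] s by (auto simp: nonpos_Ints_def)
  have Gs: "Gamma s > 0" using s by simp
  have "has_bochner_integral lborel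
      (\<lambda>p. ((s - 1) * ?K (s - 1) p - (1 - r) * ?K s p) / (real_zeta s * Gamma s))
      (((s - 1) * (Beta (x + 1) r * (Gamma (s - 1) * (x + 1) powr (- (s - 1)))) -
        (1 - r) * (Beta (x + 1) r * (Gamma s * (x + 1) powr (- s)))) / (real_zeta s * Gamma s))"
    using s r x
    by (intro has_bochner_integral_divide_zero has_bochner_integral_diff
        has_bochner_integral_mult_right has_bochner_integral_powr_log_kernel) auto
  also have "(\<lambda>p. ((s - 1) * ?K (s - 1) p - (1 - r) * ?K s p) / (real_zeta s * Gamma s))
     = (\<lambda>p. indicator {0<..<1} p * (p powr x * (1 - p) powr r * mixing_quasi_density r s p))"
  proof
    fix p :: real
    show "((s - 1) * ?K (s - 1) p - (1 - r) * ?K s p) / (real_zeta s * Gamma s)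
       = indicator {0<..<1} p * (p powr x * (1 - p) powr r * mixing_quasi_density r s p)"
    proof (cases "p \<in> {0<..<1}")
      case True
      then have "(1 - p) powr r * (1 - p) powr (- r) = 1" by (simp add: powr_minus)
      moreover have "p powr x * (1 - p) powr r * ((1 - p) powr (- r) * y / C)
          = ((1 - p) powr r * (1 - p) powr (- r)) * (p powr x * y / C)" for y C
        by simp
      ultimately have cancel: "p powr x * (1 - p) powr r * ((1 - p) powr (- r) * y / C) = p powr x * y / C" for y C
        by simp
      have "p < 1" using True by simp
      from mixing_quasi_density_eq[OF this] show ?thesis
        using True by (simp only: cancel) (simp add: algebra_simps)
    qed simp
  qed
  also have "((s - 1) * (Beta (x + 1) r * (Gamma (s - 1) * (x + 1) powr (- (s - 1)))) -
        (1 - r) * (Beta (x + 1) r * (Gamma s * (x + 1) powr (- s)))) / (real_zeta s * Gamma s)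
     = (Beta (x + 1) r * Gamma s * (x + 1) powr (- s) * ((x + 1) - (1 - r))) / (real_zeta s * Gamma s)"
  proof -
    have "(x + 1) powr (- (s - 1)) = (x + 1) * (x + 1) powr (- s)"
      using x by (simp add: powr_diff powr_minus field_simps)
    then show ?thesis unfolding G by (simp add: algebra_simps)
  qed
  also have "\<dots> = Beta (x + 1) r * (x + r) * (x + 1) powr (- s) / real_zeta s"
  proof -
    have "Gamma s \<noteq> 0" using Gs by simp
    then show ?thesis by (simp add: mult_ac del: Gamma_eq_zero_iff)
  qed
  finally show ?thesis .
qed

lemma real_zeta_sums:
  assumes "1 < s"
  shows "(\<lambda>n. (real n + 1) powr (- s)) sums real_zeta s"
proof -
  have "summable (\<lambda>n. real (Suc n) powr (- s))"
    using assms by (subst summable_Suc_iff) (simp add: summable_real_powr_iff)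
  then show ?thesis
    by (simp add: real_zeta_def summable_sums add.commute)
qed

lemma real_zeta_pos:
  assumes "1 < s"
  shows "0 < real_zeta s"
  using suminf_pos[OF sums_summable[OF real_zeta_sums[OF assms]]] sums_unique[OF real_zeta_sums[OF assms]]
  by simp

text \<open>In each term of the two series \<open>(n + 1) - (1 - r) = r + n\<close> cancels the denominator, which
  leaves the zeta series.\<close>

lemma has_bochner_integral_mixing_quasi_density:
  fixes r s :: real
  assumes s: "1 < s" and r: "0 < r"
  shows "has_bochner_integral lborel (\<lambda>p. indicator {0<..<1} p * mixing_quasi_density r s p) 1"
proof -
  let ?K = "\<lambda>a p. indicator {0<..<1} p * ((1 - p) powr (- r) * log_kernel_integral r a p)"
  let ?S = "\<lambda>a. (\<Sum>n. (real n + 1) powr (- a) / (r + real n))"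
  have G: "Gamma s = (s - 1) * Gamma (s - 1)"
    using Gamma_plus1[of "s - 1"] s by (auto simp: nonpos_Ints_def)
  have Gs: "Gamma s > 0" using s by simp
  have z: "real_zeta s > 0" using s by (rule real_zeta_pos)
  have "has_bochner_integral lborel
      (\<lambda>p. ((s - 1) * ?K (s - 1) p - (1 - r) * ?K s p) / (real_zeta s * Gamma s))
      (((s - 1) * (Gamma (s - 1) * ?S (s - 1)) - (1 - r) * (Gamma s * ?S s)) / (real_zeta s * Gamma s))"
    using s r
    by (intro has_bochner_integral_divide_zero has_bochner_integral_diff
        has_bochner_integral_mult_right has_bochner_integral_log_kernel_over_powr) auto
  also have "(\<lambda>p. ((s - 1) * ?K (s - 1) p - (1 - r) * ?K s p) / (real_zeta s * Gamma s))
     = (\<lambda>p. indicator {0<..<1} p * mixing_quasi_density r s p)"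
    by (auto simp: fun_eq_iff mixing_quasi_density_eq field_simps split: split_indicator)
  also have "((s - 1) * (Gamma (s - 1) * ?S (s - 1)) - (1 - r) * (Gamma s * ?S s)) / (real_zeta s * Gamma s)
     = (?S (s - 1) - (1 - r) * ?S s) / real_zeta s"
  proof -
    have "(s - 1) * (Gamma (s - 1) * ?S (s - 1)) - (1 - r) * (Gamma s * ?S s)
        = Gamma s * (?S (s - 1) - (1 - r) * ?S s)"
      unfolding G by (simp only: right_diff_distrib mult_ac)
    moreover have "Gamma s \<noteq> 0" using Gs by simp
    ultimately show ?thesis by (simp del: Gamma_eq_zero_iff)
  qed
  also have "?S (s - 1) - (1 - r) * ?S s = real_zeta s"
  proof -
    have "(\<lambda>n. (real n + 1) powr (- (s - 1)) / (r + real n) -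
            (1 - r) * ((real n + 1) powr (- s) / (r + real n))) sums (?S (s - 1) - (1 - r) * ?S s)"
      using s r by (intro sums_diff sums_mult summable_sums summable_powr_over_shift) auto
    also have "(\<lambda>n. (real n + 1) powr (- (s - 1)) / (r + real n) -
            (1 - r) * ((real n + 1) powr (- s) / (r + real n))) = (\<lambda>n. (real n + 1) powr (- s))"
    proof
      fix n :: nat
      have "(real n + 1) powr (- (s - 1)) = (real n + 1) * (real n + 1) powr (- s)"
        by (simp add: powr_diff powr_minus field_simps)
      moreover have "r + real n > 0" using r by simp
      ultimately show "(real n + 1) powr (- (s - 1)) / (r + real n) -
            (1 - r) * ((real n + 1) powr (- s) / (r + real n)) = (real n + 1) powr (- s)"
        by (simp add: divide_simps) (simp add: algebra_simps)
    qed
    finally show ?thesis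
      using real_zeta_sums[OF s] by (rule sums_unique2)
  qed
  finally show ?thesis using z by simp
qed

text \<open>A nonnegative density would have only nonnegative weighted moments, but the moment with an
  exponent between \<open>-1\<close> and \<open>- r\<close> is negative.\<close>

lemma mixing_quasi_density_negative:
  fixes r s :: real
  assumes s: "1 < s" and r: "0 < r" "r < 1"
  shows "\<exists>p\<in>{0<..<1}. mixing_quasi_density r s p < 0"
proof (rule ccontr)
  assume "\<not> ?thesis"
  then have nonneg: "0 \<le> mixing_quasi_density r s p" if "p \<in> {0<..<1}" for p
    using that by (auto simp: not_less)
  \<comment> \<open>the midpoint of the interval from \<open>-1\<close> to \<open>- r\<close>\<close>
  define x where "x = - (1 + r) / 2"
  have x: "-1 < x" "x + r < 0" using r by (auto simp: x_def field_simps)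
  have "0 \<le> (\<integral>p. indicator {0<..<1} p *
      (p powr x * (1 - p) powr r * mixing_quasi_density r s p) \<partial>lborel)"
    by (intro integral_nonneg_AE) (auto simp: nonneg split: split_indicator)
  also have "\<dots> = Beta (x + 1) r * (x + r) * (x + 1) powr (- s) / real_zeta s"
    using weighted_moment_mixing_quasi_density[OF s r(1) x(1)]
    by (rule has_bochner_integral_integral_eq)
  also have "\<dots> < 0"
  proof -
    have "Beta (x + 1) r > 0"
      using x r unfolding Beta_def by (intro divide_pos_pos mult_pos_pos Gamma_real_pos) auto
    then show ?thesis
      using x real_zeta_pos[OF s] by (intro divide_neg_pos mult_neg_pos mult_pos_neg) auto
  qed
  finally show False by simp
qed

theorem theorem3:
  fixes r s :: real
  assumes "1 < s" and "0 < r" and "r < 1"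
  shows "quasi_density_01 (mixing_quasi_density r s) \<and>
         is_mixture_01 (zeta_mass s) (neg_binomial_mass r) (mixing_quasi_density r s)"
proof
  show "quasi_density_01 (mixing_quasi_density r s)"
    using has_bochner_integral_mixing_quasi_density[OF assms(1,2)]
      mixing_quasi_density_negative[OF assms]
    unfolding quasi_density_01_def set_integrable_def set_lebesgue_integral_def
    by (simp add: has_bochner_integral_iff)
  show "is_mixture_01 (zeta_mass s) (neg_binomial_mass r) (mixing_quasi_density r s)"
    unfolding is_mixture_01_def
  proof
    fix n :: nat
    let ?c = "Gamma (r + real n) / (Gamma r * Gamma (real n + 1))"
    have "has_bochner_integral lborel
        (\<lambda>p. ?c * (indicator {0<..<1} p *
           (p powr real n * (1 - p) powr r * mixing_quasi_density r s p)))
        (?c * (Beta (real n + 1) r * (real n + r) * (real n + 1) powr (- s) / real_zeta s))"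
      using assms
      by (intro has_bochner_integral_mult_right weighted_moment_mixing_quasi_density) auto
    also have "(\<lambda>p. ?c * (indicator {0<..<1} p *
           (p powr real n * (1 - p) powr r * mixing_quasi_density r s p)))
        = (\<lambda>p. indicator {0<..<1} p * (neg_binomial_mass r p n * mixing_quasi_density r s p))"
      by (auto simp: fun_eq_iff neg_binomial_mass_def powr_realpow split: split_indicator)
    also have "?c * (Beta (real n + 1) r * (real n + r) * (real n + 1) powr (- s) / real_zeta s)
        = (?c * Beta (real n + 1) r) * (real n + r) * (real n + 1) powr (- s) / real_zeta s"
      by simp
    also have "\<dots> = zeta_mass s n"
      using assms(2) unfolding negative_binomial_coeff_times_Beta[OF assms(2)] zeta_mass_def
      by (simp add: add.commute)
    finally show "set_integrable lborel {0<..<1}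
          (\<lambda>p. neg_binomial_mass r p n * mixing_quasi_density r s p) \<and>
        (LBINT p:{0<..<1}. neg_binomial_mass r p n * mixing_quasi_density r s p) = zeta_mass s n"
      unfolding set_integrable_def set_lebesgue_integral_def
      by (simp add: has_bochner_integral_iff)
  qed
qed

end
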